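(* Let $p_1=2<p_2=3<p_3=5<\cdots$ be the primes in increasing order. For $i\ge 1$ let $D_i=(d^{(i)}_n)_{n\ge 0}$ be the infinite sequence over the alphabet $\{R,L\}$ defined by $d^{(i)}_n=L$ if $n$ is divisible by none of $p_1,\dots,p_i$, and $d^{(i)}_n=R$ otherwise (so $d^{(i)}_0=R$). Let $D_\infty=(d^{(\infty)}_n)_{n\ge0}$ be the sequence $RLRRR\cdots=RLR^\infty$, i.e. $d^{(\infty)}_1=L$ and $d^{(\infty)}_n=R$ for all $n\neq 1$. Then, with respect to the order on symbol sequences described in the context, $$D_1<D_2<D_3<\cdots<D_i<D_{i+1}<\cdots<D_\infty .$$
   Context: Symbol sequences: $D_i$ is the $\bullet$-composition $M_{p_1}\bullet\cdots\bullet M_{p_i}$ of the periodic sequences $M_p=(RL^{p-1})^\infty$ (position $n\ge0$ of $M_p$ is $R$ iff $p\mid n$), where the composition of two sequences is taken position-wise with $L\bullet L=L$ and $a\bullet b=R$ otherwise; this is equivalent to the explicit description in the claim. Order (the standard ordering of symbolic dynamics for unimodal maps): on single symbols $L<C<R$. Two distinct sequences $A=a_0a_1\dots$ and $B=b_0b_1\dots$ are compared at the first index $k$ where $a_k\neq b_k$: let $m$ be the number of occurrences of $R$ in the common prefix $a_0\cdots a_{k-1}$. If $m$ is even (the prefix is an "even sequence"), then $A<B$ iff $a_k<b_k$; if $m$ is odd, then $A<B$ iff $a_k>b_k$. *)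

theory Defs
  imports Complex_Main "HOL-Library.Infinite_Set" "HOL-Computational_Algebra.Primes"
begin

datatype symb = L | C | R

instantiation symb :: linorder
begin

fun less_symb :: "symb \<Rightarrow> symb \<Rightarrow> bool" where
  "less_symb L C = True"
| "less_symb L R = True"
| "less_symb C R = True"
| "less_symb _ _ = False"

definition less_eq_symb :: "symb \<Rightarrow> symb \<Rightarrow> bool" where
  "less_eq_symb a b \<longleftrightarrow> a < b \<or> a = b"

instance
proof
  fix a b c :: symb
  show "(a < b) = (a \<le> b \<and> \<not> b \<le> a)"
    by (cases a; cases b) (simp_all add: less_eq_symb_def)
  show "a \<le> a"
    by (simp add: less_eq_symb_def)
  show "a \<le> b \<Longrightarrow> b \<le> c \<Longrightarrow> a \<le> c"
    by (cases a; cases b; cases c) (simp_all add: less_eq_symb_def)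
  show "a \<le> b \<Longrightarrow> b \<le> a \<Longrightarrow> a = b"
    by (cases a; cases b) (simp_all add: less_eq_symb_def)
  show "a \<le> b \<or> b \<le> a"
    by (cases a; cases b) (simp_all add: less_eq_symb_def)
qed

end

type_synonym symb_seq = "nat \<Rightarrow> symb"

text \<open>
  The parity-lexicographic order of unimodal symbolic dynamics; \<open>k\<close> is the first index at which
  the sequences differ. It is not the pointwise order that \<open><\<close> denotes on functions, hence the
  separate symbol.
\<close>

definition seq_less :: "symb_seq \<Rightarrow> symb_seq \<Rightarrow> bool"  (infix "\<prec>" 50) where
  "A \<prec> B \<longleftrightarrow>
    (\<exists>k. (\<forall>j<k. A j = B j) \<and> A k \<noteq> B k \<and>
         (if even (card {j. j < k \<and> A j = R}) then A k < B k else A k > B k))"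

text \<open>Indexing starts at 1, so that \<open>nth_prime 1 = 2\<close>; the value at 0 is irrelevant.\<close>

definition nth_prime :: "nat \<Rightarrow> nat" where
  "nth_prime i = enumerate {p. prime p} (i - 1)"

definition D :: "nat \<Rightarrow> symb_seq" where
  "D i n = (if \<forall>k\<in>{1..i}. \<not> nth_prime k dvd n then L else R)"

definition D_inf :: symb_seq where
  "D_inf n = (if n = 1 then L else R)"

end

(* Every n \<ge> 2 below p = nth_prime (i + 1) has a prime factor among the first i primes, so D i agrees
   with D_inf before p, whereas D i p = L and D_inf p = R. The common prefix of length p contains R
   exactly p - 1 times (only position 1 is L), which is even as p is odd; hence any sequence that
   agrees with D_inf up to and including p is larger than D i. *)
theory Submission
  imports Defs
begin

lemma prime_nth_prime: "prime (nth_prime i)"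
  using enumerate_in_set[OF primes_infinite] by (auto simp: nth_prime_def)

text \<open>The bound on \<open>i\<close> matters: truncated subtraction gives
  \<open>nth_prime 0 = nth_prime 1\<close>.\<close>

lemma nth_prime_less: "1 \<le> i \<Longrightarrow> i < j \<Longrightarrow> nth_prime i < nth_prime j"
  unfolding nth_prime_def by (rule enumerate_mono[OF _ primes_infinite]) auto

lemma prime_eq_nth_prime:
  assumes "prime p"
  obtains k where "k \<ge> 1" "p = nth_prime k"
proof -
  obtain m where "enumerate {p. prime p} m = p"
    using enumerate_Ex[of "{p::nat. prime p}" p] assms primes_infinite by auto
  then have "p = nth_prime (Suc m)"
    by (simp add: nth_prime_def)
  then show thesis
    using that[of "Suc m"] by simp
qed

lemma odd_nth_prime:
  assumes "i \<ge> 2"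
  shows "odd (nth_prime i)"
proof -
  \<comment> \<open>Every prime is at least 2, so this forces \<open>nth_prime i > 2\<close>, and
    primes above 2 are odd.\<close>
  have "nth_prime 1 < nth_prime i"
    using assms by (intro nth_prime_less) auto
  then show ?thesis
    using prime_odd_nat prime_nth_prime prime_ge_2_nat[OF prime_nth_prime[of 1]] by fastforce
qed

lemma D_eq_D_inf:
  assumes "i \<ge> 1" and "n < nth_prime (Suc i)"
  shows "D i n = D_inf n"
proof (cases "n = 1")
  case True
  then show ?thesis
    using prime_nth_prime by (auto simp: D_def D_inf_def simp flip: One_nat_def) (metis not_prime_1)
next
  case False
  have "\<exists>k\<in>{1..i}. nth_prime k dvd n"
  proof (cases "n = 0")
    case True
    \<comment> \<open>Everything divides 0, so any index in \<open>{1..i}\<close> will do; this set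
      is nonempty as \<open>i \<ge> 1\<close>.\<close>
    then show ?thesis
      using assms by auto
  next
    case n: False
    obtain p where p: "prime p" "p dvd n"
      using prime_factor_nat False by blast
    obtain k where k: "k \<ge> 1" "p = nth_prime k"
      using prime_eq_nth_prime[OF p(1)] .
    have "nth_prime k < nth_prime (Suc i)"
      using dvd_imp_le[OF p(2)] n assms k by linarith
    then have "k \<le> i"
      using nth_prime_less[of "Suc i" k] by (cases "k = Suc i") (auto simp: not_le less_Suc_eq_le intro: leI)
    then show ?thesis
      using k p by auto
  qed
  then show ?thesis
    using False by (auto simp: D_def D_inf_def)
qed

text \<open>A prime divides another prime only if they are equal, which strict monotonicity of
  \<open>nth_prime\<close> rules out here.\<close>

lemma D_nth_prime_Suc: "D i (nth_prime (Suc i)) = L"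
proof -
  have "\<not> nth_prime k dvd nth_prime (Suc i)" if "k \<in> {1..i}" for k
    using primes_dvd_imp_eq[OF prime_nth_prime prime_nth_prime] nth_prime_less[of k "Suc i"] that
    by fastforce
  then show ?thesis
    by (simp add: D_def)
qed

text \<open>Leaving \<open>B\<close> general covers both \<open>D j\<close> with
  \<open>j > i\<close> and \<open>D_inf\<close> itself.\<close>

lemma D_less_of_agrees_D_inf:
  assumes "i \<ge> 1" and B: "\<And>n. n \<le> nth_prime (Suc i) \<Longrightarrow> B n = D_inf n"
  shows "D i \<prec> B"
proof -
  define p where "p = nth_prime (Suc i)"
  have p: "p > 1" "odd p"
    using prime_gt_1_nat[OF prime_nth_prime] odd_nth_prime[of "Suc i"] assms(1)
    by (auto simp: p_def)
  \<comment> \<open>As \<open>p > 1\<close>, the removed position 1 does lie below \<open>p\<close>,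
    so \<open>p - 1\<close> elements remain.\<close>
  have "{n. n < p \<and> D i n = R} = {..<p} - {1}"
    using D_eq_D_inf[OF assms(1)] by (auto simp: p_def D_inf_def)
  then have "even (card {n. n < p \<and> D i n = R})"
    using p by simp
  moreover have "\<forall>n<p. D i n = B n"
    using D_eq_D_inf[OF assms(1)] B by (simp add: p_def)
  moreover have "D i p = L" "B p = R"
    using D_nth_prime_Suc B p by (auto simp: p_def D_inf_def)
  ultimately show ?thesis
    unfolding seq_less_def by (intro exI[of _ p]) simp
qed

theorem theorem4:
  shows "(\<forall>i j. 1 \<le> i \<longrightarrow> i < j \<longrightarrow> D i \<prec> D j) \<and> (\<forall>i\<ge>1. D i \<prec> D_inf)"
proof (intro conjI allI impI)
  fix i j :: nat
  assume ij: "1 \<le> i" "i < j"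
  show "D i \<prec> D j"
  proof (rule D_less_of_agrees_D_inf[OF ij(1)])
    fix n
    assume "n \<le> nth_prime (Suc i)"
    \<comment> \<open>\<open>D j\<close> follows \<open>D_inf\<close> up to the next prime after its
      own \<open>j\<close> primes, hence beyond the index where \<open>D i\<close> departs from
      \<open>D_inf\<close>.\<close>
    also have "\<dots> < nth_prime (Suc j)"
      using ij by (intro nth_prime_less) auto
    finally show "D j n = D_inf n"
      using ij by (intro D_eq_D_inf) auto
  qed
qed (simp add: D_less_of_agrees_D_inf)

end
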